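(* Let $M\ge2$ be an integer. Under global deadline-monotonic (DM) scheduling, each of the five schedulability tests (A)–(E) defined in the context has a speedup bound of $3-\frac1M$ with respect to the optimal schedule. That is, for any sporadic task set $\tau_1,\dots,\tau_N$ indexed so that $D_1\le\dots\le D_N$ and any $k$ (with $D_k>T_k$ in the case of test (D)): if the condition of the test fails for $\tau_k$, then the task set cannot be feasibly scheduled on $M$ identical processors each running at speed $1/(3-\frac1M)$.
   Context: Model. A sporadic task $\tau_i$ has worst-case execution time $C_i>0$ (at speed 1), minimum inter-arrival time $T_i>0$, relative deadline $D_i>0$, $U_i=C_i/T_i$; it is assumed that $C_i\le D_i$ and $U_i\le1$, with no relation between $D_i$ and $T_i$. Task $\tau_i$ releases an infinite sequence of jobs with consecutive arrivals at least $T_i$ apart; a job arriving at $t$ must finish by $t+D_i$. On processors of speed $s$ each job of $\tau_i$ needs at most $C_i/s$ time units. Preemption and migration are free; at any instant at most one job of each task executes, on at most one processor. A task set can be feasibly scheduled on $M$ processors of a given speed if for every legal job arrival sequence some multiprocessor schedule meets all deadlines. Global DM: unique fixed priorities, smaller relative deadline first, here by index. Notation. $\delta_i=C_i/\min\{D_i,T_i\}$; $U_{\delta,k}^{\max}=\max\{\max_{i<k}U_i,\delta_k\}$; $work_i(t)=\lfloor t/T_i\rfloor C_i+\min\{C_i,t-\lfloor t/T_i\rfloor T_i\}$; $\omega_i^{heavy}(\Delta)=work_i(\Delta+D_i)$; for $U_i\le\rho\le1$, $\omega_i^{light}(\Delta)=\Delta$ if $0<\Delta\le C_i$ and, for $\Delta>C_i$,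 $\omega_i^{light}(\Delta)=\max\{work_i(\Delta),(p_2+1)C_i+\max\{0,C_i-\rho(T_i-q_2)\}\}$ with $p_2=\lceil(\Delta-C_i)/T_i\rceil-1$, $q_2=\Delta-C_i-p_2T_i$. Further $\omega_i^{diff}(\Delta,\rho)=\omega_i^{heavy}(\Delta)-work_i(\Delta)$ if $U_i>\rho$ and $\omega_i^{light}(\Delta)-work_i(\Delta)$ if $U_i\le\rho$. Write $D_k'=(\ell-1)T_k+D_k$, $\mu_k=M-(M-1)\rho$, $\gamma_i=1$ if $U_i>\rho$, $\gamma_i=0$ otherwise. $\mathbf{T}^{carry}$ (resp. $\mathbf{T}^{carry\text{-}approx}$) is the set of the $\lceil\mu_k\rceil-1$ tasks among $\tau_1,\dots,\tau_{k-1}$ with largest $\omega_i^{diff}(\Delta,\rho)$ (resp. largest $\gamma_iU_iD_i$), or all of them if there are fewer. Tests for $\tau_k$ (in (A) and (B), $\ell$ ranges over the positive integers, only over $\ell=1$ if $D_k\le T_k$): (A) for all $\ell$ there is $\rho\in[\ell C_k/D_k',1]$ such that for all $\Delta\ge D_k'$: $\ell C_k+\sum_{\tau_i\in\mathbf{T}^{carry}}\omega_i^{diff}(\Delta,\rho)+\sum_{i=1}^{k-1}work_i(\Delta)\le\Delta\mu_k$. (B) for all $\ell$ there is $\rho\in[\ell C_k/D_k',1]$ such that $\frac{\ell C_k}{D_k'}+\sum_{\tau_i\in\mathbf{T}^{carry\text{-}approx}}\frac{\gamma_iU_iD_i}{D_k'}+\sum_{i=1}^{k-1}(\frac{C_i-C_iU_i}{D_k'}+U_i)\le\mu_k$.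 (C) for all positive integers $\ell$: $\frac{\ell C_k}{D_k'}+\sum_{i=1}^{k-1}(\frac{C_i-C_iU_i}{D_k'}+U_i)\le M-(M-1)U_{\delta,k}^{\max}$. (D) (only for $D_k>T_k$; $b=(D_k-T_k)/T_k$) $\sum_{i=1}^kU_i\le M-(M-1)U_{\delta,k}^{\max}$ when $bU_k-\sum_{i=1}^{k-1}\frac{C_i-C_iU_i}{T_k}>0$; otherwise $\frac{C_k}{D_k}+\sum_{i=1}^{k-1}(\frac{C_i-C_iU_i}{D_k}+U_i)\le M-(M-1)U_{\delta,k}^{\max}$. (E) $\delta_k+\sum_{i=1}^{k-1}(\frac{C_i-C_iU_i}{D_k}+U_i)\le M-(M-1)U_{\delta,k}^{\max}$. *)

theory Defs
  imports "HOL-Analysis.Analysis"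
begin

section \<open>Sporadic tasks\<close>

record task =
  wcet :: real
  period :: real
  deadline :: real

definition util :: "task \<Rightarrow> real" where
  "util \<tau> = wcet \<tau> / period \<tau>"

definition sporadic_task :: "task \<Rightarrow> bool" where
  "sporadic_task \<tau> \<longleftrightarrow> 0 < wcet \<tau> \<and> 0 < period \<tau> \<and> 0 < deadline \<tau> \<and>
     wcet \<tau> \<le> deadline \<tau> \<and> util \<tau> \<le> 1"

section \<open>Feasibility on identical multiprocessors\<close>

text \<open>A task set is the family \<open>\<tau> 1, \<dots>, \<tau> N\<close>. The \<open>j\<close>-th job of task \<open>i\<close> arrives at time \<open>a i j\<close>
  and takes \<open>e i j\<close> time units on a processor of speed 1. The system starts at time 0.\<close>

definition legal_jobs ::
  "nat \<Rightarrow> (nat \<Rightarrow> task) \<Rightarrow> (nat \<Rightarrow> nat \<Rightarrow> real) \<Rightarrow> (nat \<Rightarrow> nat \<Rightarrow> real) \<Rightarrow> bool" where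
  "legal_jobs N \<tau> a e \<longleftrightarrow>
     (\<forall>i\<in>{1..N}. 0 \<le> a i 0 \<and>
        (\<forall>j. a i j + period (\<tau> i) \<le> a i (Suc j)) \<and>
        (\<forall>j. 0 < e i j \<and> e i j \<le> wcet (\<tau> i)))"

text \<open>\<open>\<sigma> p t\<close> is the job \<open>(i, j)\<close>, if any, that processor \<open>p < M\<close> executes at time \<open>t\<close>.
  Preemption and migration are unrestricted; measurability only serves to make
  the amount of time given to a job well defined. The last conjunct says that at any instant
  at most one job of a task executes, and on at most one processor.\<close>

definition schedule ::
  "nat \<Rightarrow> nat \<Rightarrow> (nat \<Rightarrow> nat \<Rightarrow> real) \<Rightarrow> (nat \<Rightarrow> real \<Rightarrow> (nat \<times> nat) option) \<Rightarrow> bool" where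
  "schedule M N a \<sigma> \<longleftrightarrow>
     (\<forall>p<M. \<forall>i j. {t. \<sigma> p t = Some (i, j)} \<in> sets lborel) \<and>
     (\<forall>p<M. \<forall>t i j. \<sigma> p t = Some (i, j) \<longrightarrow> i \<in> {1..N} \<and> a i j \<le> t) \<and>
     (\<forall>p<M. \<forall>q<M. \<forall>t i j j'. \<sigma> p t = Some (i, j) \<and> \<sigma> q t = Some (i, j') \<longrightarrow> p = q)"

definition exec_time ::
  "nat \<Rightarrow> (nat \<Rightarrow> real \<Rightarrow> (nat \<times> nat) option) \<Rightarrow> nat \<Rightarrow> nat \<Rightarrow> real \<Rightarrow> real \<Rightarrow> real" where
  "exec_time M \<sigma> i j t1 t2 = measure lborel {t \<in> {t1..t2}. \<exists>p<M. \<sigma> p t = Some (i, j)}"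

definition meets_deadlines ::
  "nat \<Rightarrow> real \<Rightarrow> nat \<Rightarrow> (nat \<Rightarrow> task) \<Rightarrow> (nat \<Rightarrow> nat \<Rightarrow> real) \<Rightarrow> (nat \<Rightarrow> nat \<Rightarrow> real) \<Rightarrow>
     (nat \<Rightarrow> real \<Rightarrow> (nat \<times> nat) option) \<Rightarrow> bool" where
  "meets_deadlines M s N \<tau> a e \<sigma> \<longleftrightarrow>
     (\<forall>i\<in>{1..N}. \<forall>j. e i j / s \<le> exec_time M \<sigma> i j (a i j) (a i j + deadline (\<tau> i)))"

definition feasible :: "nat \<Rightarrow> real \<Rightarrow> nat \<Rightarrow> (nat \<Rightarrow> task) \<Rightarrow> bool" where
  "feasible M s N \<tau> \<longleftrightarrow>
     (\<forall>a e. legal_jobs N \<tau> a e \<longrightarrow> (\<exists>\<sigma>. schedule M N a \<sigma> \<and> meets_deadlines M s N \<tau> a e \<sigma>))"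

section \<open>Workload functions\<close>

definition delta :: "task \<Rightarrow> real" where
  "delta \<tau> = wcet \<tau> / min (deadline \<tau>) (period \<tau>)"

definition U_max :: "(nat \<Rightarrow> task) \<Rightarrow> nat \<Rightarrow> real" where
  "U_max \<tau> k = Max (insert (delta (\<tau> k)) ((\<lambda>i. util (\<tau> i)) ` {1..<k}))"

definition work :: "task \<Rightarrow> real \<Rightarrow> real" where
  "work \<tau> t = \<lfloor>t / period \<tau>\<rfloor> * wcet \<tau> + min (wcet \<tau>) (t - \<lfloor>t / period \<tau>\<rfloor> * period \<tau>)"

definition omega_heavy :: "task \<Rightarrow> real \<Rightarrow> real" where
  "omega_heavy \<tau> \<Delta> = work \<tau> (\<Delta> + deadline \<tau>)"

text \<open>Only meaningful for \<open>0 < \<Delta>\<close> and \<open>util \<tau> \<le> \<rho> \<le> 1\<close>.\<close>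

definition omega_light :: "task \<Rightarrow> real \<Rightarrow> real \<Rightarrow> real" where
  "omega_light \<tau> \<Delta> \<rho> =
     (if \<Delta> \<le> wcet \<tau> then \<Delta>
      else let p2 = real_of_int (\<lceil>(\<Delta> - wcet \<tau>) / period \<tau>\<rceil> - 1);
               q2 = \<Delta> - wcet \<tau> - p2 * period \<tau>
           in max (work \<tau> \<Delta>)
                  ((p2 + 1) * wcet \<tau> + max 0 (wcet \<tau> - \<rho> * (period \<tau> - q2))))"

definition omega_diff :: "task \<Rightarrow> real \<Rightarrow> real \<Rightarrow> real" where
  "omega_diff \<tau> \<Delta> \<rho> =
     (if util \<tau> > \<rho> then omega_heavy \<tau> \<Delta> - work \<tau> \<Delta> else omega_light \<tau> \<Delta> \<rho> - work \<tau> \<Delta>)"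

definition gamma :: "task \<Rightarrow> real \<Rightarrow> real" where
  "gamma \<tau> \<rho> = (if util \<tau> > \<rho> then 1 else 0)"

definition D_ext :: "task \<Rightarrow> nat \<Rightarrow> real" where
  "D_ext \<tau> l = (real l - 1) * period \<tau> + deadline \<tau>"

definition mu :: "nat \<Rightarrow> real \<Rightarrow> real" where
  "mu M \<rho> = real M - (real M - 1) * \<rho>"

text \<open>The (at most) \<open>n\<close> indices \<open>i < k\<close> with largest \<open>f i\<close>, ties broken by smaller index.\<close>

definition largest :: "nat \<Rightarrow> (nat \<Rightarrow> real) \<Rightarrow> nat \<Rightarrow> nat set" where
  "largest n f k = set (take n (sort_key (\<lambda>i. - f i) [1..<k]))"

definition T_carry :: "nat \<Rightarrow> (nat \<Rightarrow> task) \<Rightarrow> nat \<Rightarrow> real \<Rightarrow> real \<Rightarrow> nat set" where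
  "T_carry M \<tau> k \<Delta> \<rho> = largest (nat (\<lceil>mu M \<rho>\<rceil> - 1)) (\<lambda>i. omega_diff (\<tau> i) \<Delta> \<rho>) k"

definition T_carry_approx :: "nat \<Rightarrow> (nat \<Rightarrow> task) \<Rightarrow> nat \<Rightarrow> real \<Rightarrow> nat set" where
  "T_carry_approx M \<tau> k \<rho> =
     largest (nat (\<lceil>mu M \<rho>\<rceil> - 1)) (\<lambda>i. gamma (\<tau> i) \<rho> * util (\<tau> i) * deadline (\<tau> i)) k"

section \<open>Schedulability tests\<close>

definition ells :: "task \<Rightarrow> nat set" where
  "ells \<tau> = (if deadline \<tau> \<le> period \<tau> then {1} else {1..})"

definition test_A :: "nat \<Rightarrow> (nat \<Rightarrow> task) \<Rightarrow> nat \<Rightarrow> bool" where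
  "test_A M \<tau> k \<longleftrightarrow>
     (\<forall>l\<in>ells (\<tau> k). \<exists>\<rho>\<in>{real l * wcet (\<tau> k) / D_ext (\<tau> k) l..1}. \<forall>\<Delta>\<ge>D_ext (\<tau> k) l.
        real l * wcet (\<tau> k) + (\<Sum>i\<in>T_carry M \<tau> k \<Delta> \<rho>. omega_diff (\<tau> i) \<Delta> \<rho>)
          + (\<Sum>i\<in>{1..<k}. work (\<tau> i) \<Delta>) \<le> \<Delta> * mu M \<rho>)"

text \<open>\<open>(C\<^sub>i - C\<^sub>i U\<^sub>i) / x + U\<^sub>i\<close> summed over the higher-priority tasks.\<close>

definition hp_load :: "(nat \<Rightarrow> task) \<Rightarrow> nat \<Rightarrow> real \<Rightarrow> real" where
  "hp_load \<tau> k x =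
     (\<Sum>i\<in>{1..<k}. (wcet (\<tau> i) - wcet (\<tau> i) * util (\<tau> i)) / x + util (\<tau> i))"

definition test_B :: "nat \<Rightarrow> (nat \<Rightarrow> task) \<Rightarrow> nat \<Rightarrow> bool" where
  "test_B M \<tau> k \<longleftrightarrow>
     (\<forall>l\<in>ells (\<tau> k). \<exists>\<rho>\<in>{real l * wcet (\<tau> k) / D_ext (\<tau> k) l..1}.
        real l * wcet (\<tau> k) / D_ext (\<tau> k) l
          + (\<Sum>i\<in>T_carry_approx M \<tau> k \<rho>.
               gamma (\<tau> i) \<rho> * util (\<tau> i) * deadline (\<tau> i) / D_ext (\<tau> k) l)
          + hp_load \<tau> k (D_ext (\<tau> k) l) \<le> mu M \<rho>)"

definition test_C :: "nat \<Rightarrow> (nat \<Rightarrow> task) \<Rightarrow> nat \<Rightarrow> bool" where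
  "test_C M \<tau> k \<longleftrightarrow>
     (\<forall>l\<ge>1. real l * wcet (\<tau> k) / D_ext (\<tau> k) l + hp_load \<tau> k (D_ext (\<tau> k) l)
        \<le> real M - (real M - 1) * U_max \<tau> k)"

text \<open>Only intended for tasks with \<open>deadline (\<tau> k) > period (\<tau> k)\<close>.\<close>

definition test_D :: "nat \<Rightarrow> (nat \<Rightarrow> task) \<Rightarrow> nat \<Rightarrow> bool" where
  "test_D M \<tau> k \<longleftrightarrow>
     (let b = (deadline (\<tau> k) - period (\<tau> k)) / period (\<tau> k) in
      if b * util (\<tau> k)
           - (\<Sum>i\<in>{1..<k}. (wcet (\<tau> i) - wcet (\<tau> i) * util (\<tau> i)) / period (\<tau> k)) > 0
      then (\<Sum>i\<in>{1..k}. util (\<tau> i)) \<le> real M - (real M - 1) * U_max \<tau> k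
      else wcet (\<tau> k) / deadline (\<tau> k) + hp_load \<tau> k (deadline (\<tau> k))
             \<le> real M - (real M - 1) * U_max \<tau> k)"

definition test_E :: "nat \<Rightarrow> (nat \<Rightarrow> task) \<Rightarrow> nat \<Rightarrow> bool" where
  "test_E M \<tau> k \<longleftrightarrow>
     delta (\<tau> k) + hp_load \<tau> k (deadline (\<tau> k)) \<le> real M - (real M - 1) * U_max \<tau> k"

end

theory Submission imports Defs begin

text \<open>Test (E) is the strongest of the five: it implies (C) and (D) because passing from \<open>D\<^sub>k\<close> to
  \<open>(l - 1) T\<^sub>k + D\<^sub>k\<close> only decreases the left-hand side, and (C) implies (A) and (B) by the choice
  \<open>\<rho> = U_max\<close>, for which every higher-priority task is light. It remains to derive (E) from
  feasibility at speed \<open>s = M / (3 M - 1)\<close>. Under the synchronous periodic arrival sequence, counting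
  processor time gives \<open>\<delta>\<^sub>k \<le> s\<close>, \<open>U\<^sub>i \<le> s\<close>, \<open>\<Sum>\<^sub>i C\<^sub>i \<le> M s D\<^sub>k\<close> and \<open>\<Sum>\<^sub>i U\<^sub>i \<le> M s\<close>, both sums over
  \<open>i \<le> k\<close>. Since \<open>\<delta>\<^sub>k\<close> is \<open>C\<^sub>k / D\<^sub>k\<close> or \<open>U\<^sub>k\<close>, it can be absorbed into one of the two sums, so the
  left-hand side of (E) is at most \<open>2 M s = M - (M - 1) s\<close>.\<close>

section \<open>Workload bounds\<close>

lemma sporadic_taskD:
  assumes "sporadic_task T"
  shows "0 < wcet T" "0 < period T" "0 < deadline T" "wcet T \<le> deadline T" "util T \<le> 1"
    "0 < util T" "wcet T \<le> period T"
  using assms by (auto simp: sporadic_task_def util_def divide_simps split: if_splits)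

lemma wcet_eq: "sporadic_task T \<Longrightarrow> wcet T = util T * period T"
  using sporadic_taskD(2)[of T] by (simp add: util_def)

text \<open>The line has slope \<open>util T\<close> and passes through the corners
  \<open>(n * period T + wcet T, (n + 1) * wcet T)\<close> of the staircase. Left of a corner the
  ramp has slope 1, at least that of the line; right of it the staircase is flat.\<close>

lemma work_le_linear:
  assumes T: "sporadic_task T"
  shows "work T x \<le> wcet T - wcet T * util T + util T * x"
proof -
  note pos = sporadic_taskD[OF T]
  define n where "n = real_of_int \<lfloor>x / period T\<rfloor>"
  define r where "r = x - n * period T"
  have "min (wcet T) r \<le> wcet T + util T * (r - wcet T)"
  proof (cases "r \<ge> wcet T")
    case True
    then show ?thesis using pos by simp
  next
    case False
    then have "0 \<le> (wcet T - r) * (1 - util T)" using pos by (intro mult_nonneg_nonneg) auto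
    then show ?thesis using False by (simp add: algebra_simps)
  qed
  moreover have "n * wcet T = util T * (n * period T)" by (simp add: wcet_eq[OF T])
  then have "util T * x = n * wcet T + util T * r" by (simp add: r_def right_diff_distrib)
  ultimately show ?thesis
    unfolding work_def n_def[symmetric] r_def[symmetric] by (simp add: algebra_simps)
qed

lemma work_le_self:
  assumes T: "sporadic_task T" and "0 \<le> x"
  shows "work T x \<le> x"
proof -
  note pos = sporadic_taskD[OF T]
  have "0 \<le> \<lfloor>x / period T\<rfloor>" using pos assms by simp
  then have "real_of_int \<lfloor>x / period T\<rfloor> * wcet T \<le> real_of_int \<lfloor>x / period T\<rfloor> * period T"
    using pos by (intro mult_left_mono) auto
  then show ?thesis unfolding work_def by linarith
qed

text \<open>Makes \<open>omega_diff\<close> nonnegative for light tasks, so that a sum over carry-in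
  tasks may be extended to all higher-priority tasks.\<close>

lemma work_le_omega_light:
  assumes "sporadic_task T" and "0 \<le> x"
  shows "work T x \<le> omega_light T x \<rho>"
  using work_le_self[OF assms] by (auto simp: omega_light_def Let_def)

text \<open>The line that bounds \<open>work\<close> also bounds the light carry-in workload, so
  carry-in of light tasks costs nothing extra. As \<open>util T \<le> \<rho>\<close>, the partial
  carry-in job contributes at most \<open>util T * q\<close>, which is the rise of the line over
  \<open>q\<close>.\<close>

lemma omega_light_le_linear:
  assumes T: "sporadic_task T" and "util T \<le> \<rho>"
  shows "omega_light T x \<rho> \<le> wcet T - wcet T * util T + util T * x"
proof (cases "x \<le> wcet T")
  case True
  then have "0 \<le> (wcet T - x) * (1 - util T)"
    using sporadic_taskD[OF T] by (intro mult_nonneg_nonneg) auto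
  then show ?thesis using True by (simp add: omega_light_def algebra_simps)
next
  case False
  note pos = sporadic_taskD[OF T]
  define p where "p = real_of_int (\<lceil>(x - wcet T) / period T\<rceil> - 1)"
  define q where "q = x - wcet T - p * period T"
  \<comment> \<open>The ceiling minus one places \<open>q\<close> in the interval from 0 (excluded)
    to \<open>period T\<close> (included).\<close>
  have "p < (x - wcet T) / period T" "(x - wcet T) / period T \<le> p + 1"
    unfolding p_def by linarith+
  then have q: "0 < q" "q \<le> period T"
    using pos unfolding q_def by (simp_all add: field_simps)
  have "p * wcet T = util T * (p * period T)" by (simp add: wcet_eq[OF T])
  then have lin: "wcet T - wcet T * util T + util T * x = (p + 1) * wcet T + util T * q"
    unfolding q_def right_diff_distrib distrib_right by (simp add: mult.commute)
  have "util T * (period T - q) \<le> \<rho> * (period T - q)"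
    using q assms(2) by (intro mult_right_mono) auto
  then have "wcet T - \<rho> * (period T - q) \<le> util T * q"
    using wcet_eq[OF T] by (simp add: algebra_simps)
  then have "max 0 (wcet T - \<rho> * (period T - q)) \<le> util T * q"
    using q pos by simp
  moreover have "work T x \<le> (p + 1) * wcet T + util T * q"
    using work_le_linear[OF T, of x] lin by simp
  ultimately show ?thesis
    using False unfolding omega_light_def Let_def p_def[symmetric] q_def[symmetric] lin
    by simp
qed

section \<open>Comparison of the tests\<close>

lemma largest_subset: "largest n f k \<subseteq> {1..<k}"
  unfolding largest_def by (rule order_trans[OF set_take_subset]) simp

lemma hp_load_antimono:
  assumes "\<forall>i\<in>{1..<k}. sporadic_task (\<tau> i)" and "0 < x" and "x \<le> y"
  shows "hp_load \<tau> k y \<le> hp_load \<tau> k x"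
  unfolding hp_load_def
proof (rule sum_mono)
  fix i assume "i \<in> {1..<k}"
  then have "sporadic_task (\<tau> i)" using assms by blast
  note pos = sporadic_taskD[OF this]
  have "0 \<le> wcet (\<tau> i) - wcet (\<tau> i) * util (\<tau> i)" using pos by simp
  then show "(wcet (\<tau> i) - wcet (\<tau> i) * util (\<tau> i)) / y + util (\<tau> i)
      \<le> (wcet (\<tau> i) - wcet (\<tau> i) * util (\<tau> i)) / x + util (\<tau> i)"
    using assms by (simp add: divide_left_mono)
qed

lemma D_ext_ge: "sporadic_task T \<Longrightarrow> 1 \<le> l \<Longrightarrow> deadline T \<le> D_ext T l"
  using sporadic_taskD[of T] by (simp add: D_ext_def)

text \<open>\<open>D_ext T l\<close> consists of \<open>l - 1\<close> periods and one deadline, each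
  at least \<open>min (deadline T) (period T)\<close>.\<close>

lemma wcet_D_ext_le_delta:
  assumes "sporadic_task T" and "1 \<le> l"
  shows "real l * wcet T / D_ext T l \<le> delta T"
proof -
  note pos = sporadic_taskD[OF assms(1)]
  define m where "m = min (deadline T) (period T)"
  have m: "0 < m" "m \<le> deadline T" "m \<le> period T" using pos by (auto simp: m_def)
  have "(real l - 1) * m + m \<le> D_ext T l"
    unfolding D_ext_def using m assms(2) by (intro add_mono mult_left_mono) auto
  then have le: "real l * m \<le> D_ext T l" by (simp add: algebra_simps)
  have "real l * wcet T / D_ext T l \<le> real l * wcet T / (real l * m)"
  proof (rule divide_left_mono[OF le])
    have "0 < real l * m" using m(1) assms(2) by simp
    then show "0 < D_ext T l * (real l * m)" using le by (simp only: mult_pos_pos less_le_trans)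
  qed (use pos(1) in simp)
  then show ?thesis using assms(2) by (simp add: delta_def m_def)
qed

lemma util_le_delta: "sporadic_task T \<Longrightarrow> util T \<le> delta T"
  using sporadic_taskD[of T] unfolding util_def delta_def
  by (intro divide_left_mono mult_pos_pos) auto

lemma delta_le_1: "sporadic_task T \<Longrightarrow> delta T \<le> 1"
  using sporadic_taskD[of T] by (simp add: delta_def)

lemma U_max_ge:
  shows delta_le_U_max: "delta (\<tau> k) \<le> U_max \<tau> k"
    and util_le_U_max: "i \<in> {1..<k} \<Longrightarrow> util (\<tau> i) \<le> U_max \<tau> k"
  unfolding U_max_def by (rule Max_ge; simp)+

lemma U_max_le:
  assumes "delta (\<tau> k) \<le> s" and "\<And>i. i \<in> {1..<k} \<Longrightarrow> util (\<tau> i) \<le> s"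
  shows "U_max \<tau> k \<le> s"
  unfolding U_max_def using assms by (subst Max_le_iff) auto

lemma D_ext_pos: "sporadic_task T \<Longrightarrow> 1 \<le> l \<Longrightarrow> 0 < D_ext T l"
  using D_ext_ge[of T l] sporadic_taskD(3)[of T] by linarith

text \<open>\<open>U_max\<close> is thus an admissible \<open>\<rho>\<close> in tests (A) and (B),
  the same for every \<open>l\<close>.\<close>

lemma U_max_mem:
  assumes sporadic_k: "sporadic_task (\<tau> k)" and hp_sporadic: "\<forall>i\<in>{1..<k}. sporadic_task (\<tau> i)"
    and "1 \<le> l"
  shows "U_max \<tau> k \<in> {real l * wcet (\<tau> k) / D_ext (\<tau> k) l..1}"
proof -
  have "U_max \<tau> k \<le> 1"
    using hp_sporadic delta_le_1[OF sporadic_k] by (intro U_max_le) (auto dest: sporadic_taskD(5))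
  then show ?thesis
    using wcet_D_ext_le_delta[OF assms(1,3)] delta_le_U_max[of \<tau> k] by simp
qed

lemma test_E_imp_test_C:
  assumes sporadic_k: "sporadic_task (\<tau> k)" and hp_sporadic: "\<forall>i\<in>{1..<k}. sporadic_task (\<tau> i)"
    and "test_E M \<tau> k"
  shows "test_C M \<tau> k"
  unfolding test_C_def
proof (intro allI impI)
  fix l :: nat assume l: "1 \<le> l"
  have "hp_load \<tau> k (D_ext (\<tau> k) l) \<le> hp_load \<tau> k (deadline (\<tau> k))"
    by (rule hp_load_antimono[OF hp_sporadic sporadic_taskD(3)[OF sporadic_k] D_ext_ge[OF sporadic_k l]])
  then show "real l * wcet (\<tau> k) / D_ext (\<tau> k) l + hp_load \<tau> k (D_ext (\<tau> k) l)
      \<le> real M - (real M - 1) * U_max \<tau> k"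
    using assms wcet_D_ext_le_delta[OF sporadic_k l] unfolding test_E_def by linarith
qed

text \<open>Both branches of (D) have a left-hand side at most that of (E): one drops the
  nonnegative fractions in \<open>hp_load\<close> and uses \<open>util \<le> delta\<close>, the
  other uses the bound by \<open>delta\<close> for \<open>l = 1\<close>.\<close>

lemma test_E_imp_test_D:
  assumes sporadic_k: "sporadic_task (\<tau> k)" and hp_sporadic: "\<forall>i\<in>{1..<k}. sporadic_task (\<tau> i)"
    and k_pos: "1 \<le> k"
    and "test_E M \<tau> k"
  shows "test_D M \<tau> k"
proof -
  note pos = sporadic_taskD[OF sporadic_k]
  have "sum (\<lambda>i. util (\<tau> i)) {1..<k} \<le> hp_load \<tau> k (deadline (\<tau> k))"
    unfolding hp_load_def
  proof (rule sum_mono)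
    fix i assume "i \<in> {1..<k}"
    then have "sporadic_task (\<tau> i)" using hp_sporadic by blast
    note sporadic_taskD[OF this]
    then have "0 \<le> wcet (\<tau> i) - wcet (\<tau> i) * util (\<tau> i)" by simp
    then show "util (\<tau> i)
        \<le> (wcet (\<tau> i) - wcet (\<tau> i) * util (\<tau> i)) / deadline (\<tau> k) + util (\<tau> i)"
      using pos by simp
  qed
  moreover have "{1..k} = insert k {1..<k}" using k_pos by auto
  ultimately have "(\<Sum>i\<in>{1..k}. util (\<tau> i)) \<le> delta (\<tau> k) + hp_load \<tau> k (deadline (\<tau> k))"
    using util_le_delta[OF sporadic_k] by simp
  moreover have "wcet (\<tau> k) / deadline (\<tau> k) \<le> delta (\<tau> k)"
    using wcet_D_ext_le_delta[OF sporadic_k, of 1] by (simp add: D_ext_def)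
  ultimately show ?thesis
    using assms(4) unfolding test_E_def test_D_def Let_def
    by (simp split: if_split)
qed

text \<open>At \<open>\<rho> = U_max\<close> every \<open>gamma\<close> vanishes, and (B) for
  \<open>l\<close> becomes the inequality of (C) for the same \<open>l\<close>.\<close>

lemma test_C_imp_test_B:
  assumes sporadic_k: "sporadic_task (\<tau> k)" and hp_sporadic: "\<forall>i\<in>{1..<k}. sporadic_task (\<tau> i)"
    and "test_C M \<tau> k"
  shows "test_B M \<tau> k"
  unfolding test_B_def
proof
  fix l assume "l \<in> ells (\<tau> k)"
  then have l: "1 \<le> l" by (auto simp: ells_def split: if_splits)
  have "gamma (\<tau> i) (U_max \<tau> k) = 0" if "i \<in> T_carry_approx M \<tau> k \<rho>" for i \<rho>
  proof -
    have "i \<in> {1..<k}" using that largest_subset unfolding T_carry_approx_def by blast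
    then show ?thesis using util_le_U_max[of i k \<tau>] by (simp add: gamma_def)
  qed
  then show "\<exists>\<rho>\<in>{real l * wcet (\<tau> k) / D_ext (\<tau> k) l..1}.
        real l * wcet (\<tau> k) / D_ext (\<tau> k) l
          + (\<Sum>i\<in>T_carry_approx M \<tau> k \<rho>.
               gamma (\<tau> i) \<rho> * util (\<tau> i) * deadline (\<tau> i) / D_ext (\<tau> k) l)
          + hp_load \<tau> k (D_ext (\<tau> k) l) \<le> mu M \<rho>"
    using assms l unfolding test_C_def
    by (intro bexI[OF _ U_max_mem[OF sporadic_k hp_sporadic l]]) (simp add: mu_def)
qed

text \<open>At \<open>\<rho> = U_max\<close> carry-in and regular work together are at most the sum
  of the light workloads, hence linear in the window length. After division by that length the bound
  is worst at \<open>D_ext\<close>, where it is (C).\<close>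

lemma test_C_imp_test_A:
  assumes sporadic_k: "sporadic_task (\<tau> k)" and hp_sporadic: "\<forall>i\<in>{1..<k}. sporadic_task (\<tau> i)"
    and C: "test_C M \<tau> k"
  shows "test_A M \<tau> k"
  unfolding test_A_def
proof
  fix l assume "l \<in> ells (\<tau> k)"
  then have l: "1 \<le> l" by (auto simp: ells_def split: if_splits)
  define \<rho> where "\<rho> = U_max \<tau> k"
  have "real l * wcet (\<tau> k) + (\<Sum>i\<in>T_carry M \<tau> k x \<rho>. omega_diff (\<tau> i) x \<rho>)
          + (\<Sum>i\<in>{1..<k}. work (\<tau> i) x) \<le> x * mu M \<rho>"
    if x: "x \<ge> D_ext (\<tau> k) l" for x
  proof -
    have x0: "0 < x" using D_ext_pos[OF sporadic_k l] x by linarith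
    have diff: "omega_diff (\<tau> i) x \<rho> = omega_light (\<tau> i) x \<rho> - work (\<tau> i) x" if "i \<in> {1..<k}" for i
      using util_le_U_max[OF that, of \<tau>] by (simp add: omega_diff_def \<rho>_def)
    have "(\<Sum>i\<in>T_carry M \<tau> k x \<rho>. omega_diff (\<tau> i) x \<rho>) \<le> (\<Sum>i\<in>{1..<k}. omega_diff (\<tau> i) x \<rho>)"
    proof (rule sum_mono2)
      show "T_carry M \<tau> k x \<rho> \<subseteq> {1..<k}" unfolding T_carry_def by (rule largest_subset)
      show "0 \<le> omega_diff (\<tau> i) x \<rho>" if "i \<in> {1..<k} - T_carry M \<tau> k x \<rho>" for i
        using that hp_sporadic x0 diff[of i] work_le_omega_light[of "\<tau> i" x \<rho>] by simp
    qed simp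
    \<comment> \<open>The subtracted \<open>work\<close> sum cancels the one in the test.\<close>
    also have "\<dots> = (\<Sum>i\<in>{1..<k}. omega_light (\<tau> i) x \<rho>) - (\<Sum>i\<in>{1..<k}. work (\<tau> i) x)"
      by (simp add: diff sum_subtractf)
    also have "(\<Sum>i\<in>{1..<k}. omega_light (\<tau> i) x \<rho>)
        \<le> (\<Sum>i\<in>{1..<k}. wcet (\<tau> i) - wcet (\<tau> i) * util (\<tau> i) + util (\<tau> i) * x)"
      using hp_sporadic util_le_U_max[of _ k \<tau>]
      by (intro sum_mono omega_light_le_linear) (auto simp: \<rho>_def)
    also have "\<dots> = x * hp_load \<tau> k x"
      unfolding hp_load_def sum_distrib_left
      using x0 by (intro sum.cong) (auto simp: field_simps)
    also have "\<dots> \<le> x * hp_load \<tau> k (D_ext (\<tau> k) l)"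
      using hp_load_antimono[OF hp_sporadic D_ext_pos[OF sporadic_k l] x] x0 by (intro mult_left_mono) auto
    finally have hp: "(\<Sum>i\<in>T_carry M \<tau> k x \<rho>. omega_diff (\<tau> i) x \<rho>) + (\<Sum>i\<in>{1..<k}. work (\<tau> i) x)
        \<le> x * hp_load \<tau> k (D_ext (\<tau> k) l)" by simp
    \<comment> \<open>The fixed demand of task \<open>k\<close> is turned into a rate, so that it
      scales with \<open>x\<close> like the other terms.\<close>
    have "real l * wcet (\<tau> k) = D_ext (\<tau> k) l * (real l * wcet (\<tau> k) / D_ext (\<tau> k) l)"
      using D_ext_pos[OF sporadic_k l] by simp
    also have "\<dots> \<le> x * (real l * wcet (\<tau> k) / D_ext (\<tau> k) l)"
      using x D_ext_pos[OF sporadic_k l] sporadic_taskD(1)[OF sporadic_k] by (intro mult_right_mono) auto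
    finally have "real l * wcet (\<tau> k) + (\<Sum>i\<in>T_carry M \<tau> k x \<rho>. omega_diff (\<tau> i) x \<rho>)
        + (\<Sum>i\<in>{1..<k}. work (\<tau> i) x)
      \<le> x * (real l * wcet (\<tau> k) / D_ext (\<tau> k) l + hp_load \<tau> k (D_ext (\<tau> k) l))"
      using hp by (simp add: algebra_simps)
    also have "\<dots> \<le> x * mu M \<rho>"
      using C l x0 unfolding test_C_def mu_def \<rho>_def by (intro mult_left_mono) auto
    finally show ?thesis .
  qed
  then show "\<exists>\<rho>\<in>{real l * wcet (\<tau> k) / D_ext (\<tau> k) l..1}. \<forall>\<Delta>\<ge>D_ext (\<tau> k) l.
        real l * wcet (\<tau> k) + (\<Sum>i\<in>T_carry M \<tau> k \<Delta> \<rho>. omega_diff (\<tau> i) \<Delta> \<rho>)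
          + (\<Sum>i\<in>{1..<k}. work (\<tau> i) \<Delta>) \<le> \<Delta> * mu M \<rho>"
    using U_max_mem[OF sporadic_k hp_sporadic l] unfolding \<rho>_def by blast
qed

section \<open>Necessary conditions for feasibility\<close>

lemma sum_measure_disjoint_le:
  fixes A :: "'a \<Rightarrow> real set"
  assumes "finite J" and "\<And>x. x \<in> J \<Longrightarrow> A x \<in> sets lborel" and "disjoint_family_on A J"
    and sub: "\<And>x. x \<in> J \<Longrightarrow> A x \<subseteq> {0..L}" and "0 \<le> L"
  shows "(\<Sum>x\<in>J. measure lborel (A x)) \<le> L"
proof -
  have fin: "emeasure lborel {0..L} < \<infinity>" using \<open>0 \<le> L\<close> by simp
  \<comment> \<open>\<open>measure\<close> is 0 on sets of infinite \<open>emeasure\<close>, so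
    additivity requires finiteness.\<close>
  have "emeasure lborel (A x) \<noteq> \<infinity>" if "x \<in> J" for x
    using emeasure_mono[OF sub[OF that], of lborel] fin by (auto simp: top_unique)
  then have "(\<Sum>x\<in>J. measure lborel (A x)) = measure lborel (\<Union>x\<in>J. A x)"
    by (intro measure_finite_Union[symmetric] image_subsetI assms)
  also have "\<dots> \<le> measure lborel {0..L}"
  proof (rule measure_mono_fmeasurable)
    show "(\<Union>x\<in>J. A x) \<in> sets lborel" using assms(1,2) by (rule sets.finite_UN)
    show "{0..L} \<in> fmeasurable lborel" using fin by (intro fmeasurableI) simp_all
  qed (rule UN_least[OF sub])
  finally show ?thesis using \<open>0 \<le> L\<close> by simp
qed

lemma schedule_measurable:
  assumes "schedule M N a \<sigma>" and "p < M"
  shows "{t \<in> {t1..t2}. \<sigma> p t = Some (i, j)} \<in> sets lborel"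
proof -
  have "{t. \<sigma> p t = Some (i, j)} \<in> sets lborel" using assms unfolding schedule_def by blast
  then have "{t1..t2} \<inter> {t. \<sigma> p t = Some (i, j)} \<in> sets lborel" by (intro sets.Int) simp_all
  then show ?thesis unfolding Int_def mem_Collect_eq .
qed

text \<open>Jobs of one task never run simultaneously, even on different processors, so their
  execution times are disjoint sets and the bound has no factor \<open>M\<close>.\<close>

lemma sum_exec_time_task_le:
  assumes \<sigma>: "schedule M N a \<sigma>" and "finite J" and "0 \<le> L"
    and J: "\<And>j. j \<in> J \<Longrightarrow> 0 \<le> u j \<and> v j \<le> L"
  shows "(\<Sum>j\<in>J. exec_time M \<sigma> i j (u j) (v j)) \<le> L"
  unfolding exec_time_def
proof (rule sum_measure_disjoint_le)
  fix j assume "j \<in> J"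
  have "{t \<in> {u j..v j}. \<exists>p<M. \<sigma> p t = Some (i, j)}
      = (\<Union>p<M. {t \<in> {u j..v j}. \<sigma> p t = Some (i, j)})" by auto
  also have "\<dots> \<in> sets lborel"
    by (intro sets.finite_UN schedule_measurable[OF \<sigma>]) simp_all
  finally show "{t \<in> {u j..v j}. \<exists>p<M. \<sigma> p t = Some (i, j)} \<in> sets lborel" .
  show "{t \<in> {u j..v j}. \<exists>p<M. \<sigma> p t = Some (i, j)} \<subseteq> {0..L}"
    using J[OF \<open>j \<in> J\<close>] by auto
next
  show "disjoint_family_on (\<lambda>j. {t \<in> {u j..v j}. \<exists>p<M. \<sigma> p t = Some (i, j)}) J"
  proof -
    have "j = j'" if "\<sigma> p t = Some (i, j)" "\<sigma> q t = Some (i, j')" "p < M" "q < M" for p q t j j'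
    proof -
      have "p = q" using \<sigma> that unfolding schedule_def by meson
      then show ?thesis using that by simp
    qed
    then show ?thesis unfolding disjoint_family_on_def by fast
  qed
qed (fact assms)+

text \<open>A single processor runs one job at a time and contributes at most \<open>L\<close>; each
  job's time is split over the processors and the two sums are swapped.\<close>

lemma sum_exec_time_le:
  assumes \<sigma>: "schedule M N a \<sigma>" and "finite J" and "0 \<le> L"
    and J: "\<And>i j. (i, j) \<in> J \<Longrightarrow> 0 \<le> u i j \<and> v i j \<le> L"
  shows "(\<Sum>(i, j)\<in>J. exec_time M \<sigma> i j (u i j) (v i j)) \<le> real M * L"
proof -
  define A where "A p x = {t \<in> {u (fst x) (snd x)..v (fst x) (snd x)}. \<sigma> p t = Some x}" for p x
  have meas: "A p x \<in> sets lborel" if "p < M" for p x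
    using schedule_measurable[OF \<sigma> that, of _ _ "fst x" "snd x"] by (simp only: A_def prod.collapse)
  have sub: "A p x \<subseteq> {0..L}" if "x \<in> J" for p x
    using J[of "fst x" "snd x"] that unfolding A_def by auto
  have "(\<Sum>(i, j)\<in>J. exec_time M \<sigma> i j (u i j) (v i j)) \<le> (\<Sum>x\<in>J. \<Sum>p<M. measure lborel (A p x))"
  proof (rule sum_mono)
    fix x assume "x \<in> J"
    obtain i j where x: "x = (i, j)" by fastforce
    have eq: "{t \<in> {u i j..v i j}. \<exists>p<M. \<sigma> p t = Some (i, j)} = (\<Union>p<M. A p x)"
      unfolding A_def x by auto
    have "measure lborel (\<Union>p<M. A p x) \<le> (\<Sum>p<M. measure lborel (A p x))"
    proof (rule measure_UNION_le)
      show "A p x \<in> sets lborel" if "p \<in> {..<M}" for p using meas that by simp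
    qed simp
    then show "(case x of (i, j) \<Rightarrow> exec_time M \<sigma> i j (u i j) (v i j))
        \<le> (\<Sum>p<M. measure lborel (A p x))"
      unfolding exec_time_def x prod.case eq[unfolded x] .
  qed
  also have "\<dots> = (\<Sum>p<M. \<Sum>x\<in>J. measure lborel (A p x))" by (rule sum.swap)
  also have "\<dots> \<le> (\<Sum>p<M. L)"
  proof (rule sum_mono)
    fix p assume "p \<in> {..<M}"
    then have "p < M" by simp
    have "disjoint_family_on (A p) J"
      unfolding disjoint_family_on_def A_def by auto
    then show "(\<Sum>x\<in>J. measure lborel (A p x)) \<le> L"
      by (rule sum_measure_disjoint_le[OF assms(2) meas[OF \<open>p < M\<close>] _ sub assms(3)])
  qed
  finally show ?thesis by simp
qed

text \<open>Passage to infinitely long windows: \<open>L\<close> is the window length and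
  \<open>x\<close> an excess of demand rate over capacity.\<close>

lemma nonpos_if_linearly_bounded:
  fixes x B :: real
  assumes "\<And>L. L \<ge> L0 \<Longrightarrow> L * x \<le> B"
  shows "x \<le> 0"
proof (rule ccontr)
  assume "\<not> x \<le> 0"
  then have "0 < x" by simp
  define L where "L = max L0 ((B + 1) / x)"
  have "(B + 1) / x \<le> L" by (simp add: L_def)
  then have "B + 1 \<le> L * x" using \<open>0 < x\<close> by (simp add: pos_divide_le_eq)
  moreover have "L * x \<le> B" by (rule assms) (simp add: L_def)
  ultimately show False by simp
qed

section \<open>Feasibility on synchronous periodic arrivals\<close>

lemma periodic_schedule:
  assumes sporadic: "\<forall>i\<in>{1..N}. sporadic_task (\<tau> i)" and feasible: "feasible M s N \<tau>"
  obtains \<sigma> where "schedule M N (\<lambda>i j. real j * period (\<tau> i)) \<sigma>"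
    and "\<And>i j. i \<in> {1..N} \<Longrightarrow> wcet (\<tau> i) / s \<le>
      exec_time M \<sigma> i j (real j * period (\<tau> i)) (real j * period (\<tau> i) + deadline (\<tau> i))"
proof -
  have "legal_jobs N \<tau> (\<lambda>i j. real j * period (\<tau> i)) (\<lambda>i j. wcet (\<tau> i))"
    unfolding legal_jobs_def using sporadic
    by (auto simp: algebra_simps dest: sporadic_taskD)
  then show ?thesis
    using feasible that unfolding feasible_def meets_deadlines_def by blast
qed

text \<open>Counts the first \<open>n\<close> jobs of one task. The window of the first bound is one
  period longer than the last deadline, which does not affect the limit of large \<open>n\<close>;
  the second bound has the exact window of the first job.\<close>

lemma feasible_wcet_le:
  assumes s_pos: "0 < s" and sporadic: "\<forall>i\<in>{1..N}. sporadic_task (\<tau> i)"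
    and feasible: "feasible M s N \<tau>"
    and i: "i \<in> {1..N}"
  shows "real n * wcet (\<tau> i) \<le> s * (real n * period (\<tau> i) + deadline (\<tau> i))"
    and "wcet (\<tau> i) \<le> s * deadline (\<tau> i)"
proof -
  obtain \<sigma> where \<sigma>: "schedule M N (\<lambda>i j. real j * period (\<tau> i)) \<sigma>"
    and meet: "\<And>i j. i \<in> {1..N} \<Longrightarrow> wcet (\<tau> i) / s \<le>
      exec_time M \<sigma> i j (real j * period (\<tau> i)) (real j * period (\<tau> i) + deadline (\<tau> i))"
    using periodic_schedule[OF sporadic feasible] by blast
  have T: "sporadic_task (\<tau> i)" using sporadic i by blast
  note pos = sporadic_taskD[OF T]
  have bound: "real n * (wcet (\<tau> i) / s) \<le> L"
    if "0 \<le> L" and L: "\<And>j. j < n \<Longrightarrow> real j * period (\<tau> i) + deadline (\<tau> i) \<le> L" for n L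
  proof -
    have "real n * (wcet (\<tau> i) / s) = (\<Sum>j<n. wcet (\<tau> i) / s)" by simp
    also have "\<dots> \<le> (\<Sum>j<n. exec_time M \<sigma> i j
        (real j * period (\<tau> i)) (real j * period (\<tau> i) + deadline (\<tau> i)))"
      using meet[OF i] by (intro sum_mono)
    also have "\<dots> \<le> L"
      using that pos(2) by (intro sum_exec_time_task_le[OF \<sigma>]) simp_all
    finally show ?thesis .
  qed
  have "real n * (wcet (\<tau> i) / s) \<le> real n * period (\<tau> i) + deadline (\<tau> i)"
    using pos by (intro bound) (auto intro: mult_right_mono)
  then show "real n * wcet (\<tau> i) \<le> s * (real n * period (\<tau> i) + deadline (\<tau> i))"
    using s_pos by (simp add: pos_divide_le_eq mult.commute)
  have "real 1 * (wcet (\<tau> i) / s) \<le> deadline (\<tau> i)"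
    using pos by (intro bound) auto
  then show "wcet (\<tau> i) \<le> s * deadline (\<tau> i)"
    using s_pos by (simp add: pos_divide_le_eq mult.commute)
qed

text \<open>A positive excess \<open>wcet - s * period\<close> would accumulate over
  \<open>n\<close> jobs beyond the constant \<open>s * deadline\<close>.\<close>

lemma feasible_util_le:
  assumes s_pos: "0 < s" and sporadic: "\<forall>i\<in>{1..N}. sporadic_task (\<tau> i)"
    and feasible: "feasible M s N \<tau>"
    and i: "i \<in> {1..N}"
  shows "util (\<tau> i) \<le> s"
proof -
  have "sporadic_task (\<tau> i)" using sporadic i by blast
  note pos = sporadic_taskD[OF this]
  have "wcet (\<tau> i) - s * period (\<tau> i) \<le> 0"
  proof (rule ccontr)
    assume "\<not> ?thesis"
    then have "0 < wcet (\<tau> i) - s * period (\<tau> i)" by simp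
    then obtain n where "s * deadline (\<tau> i) < real n * (wcet (\<tau> i) - s * period (\<tau> i))"
      using reals_Archimedean3 by blast
    then show False using feasible_wcet_le(1)[OF assms, of n] by (simp add: algebra_simps)
  qed
  then show ?thesis using pos by (simp add: util_def pos_divide_le_eq)
qed

lemma feasible_delta_le:
  assumes s_pos: "0 < s" and sporadic: "\<forall>i\<in>{1..N}. sporadic_task (\<tau> i)"
    and feasible: "feasible M s N \<tau>"
    and i: "i \<in> {1..N}"
  shows "delta (\<tau> i) \<le> s"
proof -
  have "sporadic_task (\<tau> i)" using sporadic i by blast
  note pos = sporadic_taskD[OF this]
  have "wcet (\<tau> i) \<le> s * period (\<tau> i)"
    using feasible_util_le[OF assms] pos by (simp add: util_def pos_divide_le_eq)
  then show ?thesis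
    using feasible_wcet_le(2)[OF assms] pos by (simp add: delta_def min_def pos_divide_le_eq)
qed

text \<open>The first \<open>n i\<close> jobs of each task in \<open>I\<close> must run entirely
  inside \<open>{0..L}\<close>, where \<open>M\<close> processors offer time \<open>M * L\<close>.
  Below, \<open>n\<close> is 1 for the deadline bound and grows with \<open>L\<close> for the
  utilization bound.\<close>

lemma feasible_demand_le:
  assumes s_pos: "0 < s" and sporadic: "\<forall>i\<in>{1..N}. sporadic_task (\<tau> i)"
    and feasible: "feasible M s N \<tau>"
    and I: "I \<subseteq> {1..N}" and "0 \<le> L"
    and L: "\<And>i j. i \<in> I \<Longrightarrow> j < n i \<Longrightarrow> real j * period (\<tau> i) + deadline (\<tau> i) \<le> L"
  shows "(\<Sum>i\<in>I. real (n i) * wcet (\<tau> i)) \<le> real M * s * L"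
proof -
  obtain \<sigma> where \<sigma>: "schedule M N (\<lambda>i j. real j * period (\<tau> i)) \<sigma>"
    and meet: "\<And>i j. i \<in> {1..N} \<Longrightarrow> wcet (\<tau> i) / s \<le>
      exec_time M \<sigma> i j (real j * period (\<tau> i)) (real j * period (\<tau> i) + deadline (\<tau> i))"
    using periodic_schedule[OF sporadic feasible] by blast
  have fin: "finite I" using I finite_subset by blast
  define J where "J = Sigma I (\<lambda>i. {..<n i})"
  have "(\<Sum>i\<in>I. real (n i) * wcet (\<tau> i)) / s = (\<Sum>i\<in>I. \<Sum>j<n i. wcet (\<tau> i) / s)"
    by (simp add: sum_divide_distrib)
  also have "\<dots> = (\<Sum>(i, j)\<in>J. wcet (\<tau> i) / s)"
    unfolding J_def using fin by (intro sum.Sigma) auto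
  also have "\<dots> \<le> (\<Sum>(i, j)\<in>J. exec_time M \<sigma> i j
      (real j * period (\<tau> i)) (real j * period (\<tau> i) + deadline (\<tau> i)))"
    using meet I unfolding J_def by (intro sum_mono) auto
  also have "\<dots> \<le> real M * L"
  proof (rule sum_exec_time_le[OF \<sigma> _ \<open>0 \<le> L\<close>])
    show "finite J" unfolding J_def using fin by simp
    show "0 \<le> real j * period (\<tau> i) \<and> real j * period (\<tau> i) + deadline (\<tau> i) \<le> L"
      if "(i, j) \<in> J" for i j
    proof -
      have ij: "i \<in> I" "j < n i" using that by (auto simp: J_def)
      then have "sporadic_task (\<tau> i)" using I sporadic by blast
      then show ?thesis using L[OF ij] by (simp add: sporadic_taskD(2) less_imp_le)
    qed
  qed
  finally show ?thesis using s_pos by (simp add: pos_divide_le_eq algebra_simps)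
qed

text \<open>In a window of length \<open>L\<close> the demand is at least the total utilization
  times \<open>L\<close> up to a constant, and the capacity is \<open>M * s * L\<close>; large
  \<open>L\<close> compares the slopes.\<close>

lemma feasible_sum_util_le:
  assumes s_pos: "0 < s" and sporadic: "\<forall>i\<in>{1..N}. sporadic_task (\<tau> i)"
    and feasible: "feasible M s N \<tau>"
    and I: "I \<subseteq> {1..N}"
  shows "(\<Sum>i\<in>I. util (\<tau> i)) \<le> real M * s"
proof -
  have fin: "finite I" using I finite_subset by blast
  have T: "sporadic_task (\<tau> i)" if "i \<in> I" for i using that I sporadic by blast
  \<comment> \<open>The sum is an upper bound for every deadline and is also defined when
    \<open>I\<close> is empty.\<close>
  define D where "D = (\<Sum>i\<in>I. deadline (\<tau> i))"
  have D: "deadline (\<tau> i) \<le> D" if "i \<in> I" for i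
    unfolding D_def using that fin T by (intro member_le_sum) (auto intro: less_imp_le sporadic_taskD(3))
  have D0: "0 \<le> D" unfolding D_def using T by (intro sum_nonneg less_imp_le sporadic_taskD(3))
  have "(\<Sum>i\<in>I. util (\<tau> i)) - real M * s \<le> 0"
  proof (rule nonpos_if_linearly_bounded)
    fix L assume L: "L \<ge> D"
    \<comment> \<open>One job fewer than have their deadline by \<open>L\<close>; the loss is a
      constant independent of \<open>L\<close>.\<close>
    define n where "n i = nat \<lfloor>(L - deadline (\<tau> i)) / period (\<tau> i)\<rfloor>" for i
    have n: "real (n i) \<le> (L - deadline (\<tau> i)) / period (\<tau> i)"
        "(L - deadline (\<tau> i)) / period (\<tau> i) \<le> real (n i) + 1" if "i \<in> I" for i
    proof -
      have "0 \<le> (L - deadline (\<tau> i)) / period (\<tau> i)"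
        using D[OF that] L sporadic_taskD(2)[OF T[OF that]] by simp
      then show "real (n i) \<le> (L - deadline (\<tau> i)) / period (\<tau> i)"
        "(L - deadline (\<tau> i)) / period (\<tau> i) \<le> real (n i) + 1"
        unfolding n_def by linarith+
    qed
    have "(\<Sum>i\<in>I. util (\<tau> i) * (L - deadline (\<tau> i) - period (\<tau> i)))
        \<le> (\<Sum>i\<in>I. real (n i) * wcet (\<tau> i))"
    proof (rule sum_mono)
      fix i assume i: "i \<in> I"
      note pos = sporadic_taskD[OF T[OF i]]
      have "L - deadline (\<tau> i) - period (\<tau> i) \<le> real (n i) * period (\<tau> i)"
        using n(2)[OF i] pos by (simp add: field_simps)
      then have "util (\<tau> i) * (L - deadline (\<tau> i) - period (\<tau> i))
          \<le> util (\<tau> i) * (real (n i) * period (\<tau> i))"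
        using pos by (intro mult_left_mono) auto
      also have "\<dots> = real (n i) * wcet (\<tau> i)" by (simp add: wcet_eq[OF T[OF i]])
      finally show "util (\<tau> i) * (L - deadline (\<tau> i) - period (\<tau> i)) \<le> real (n i) * wcet (\<tau> i)" .
    qed
    also have "\<dots> \<le> real M * s * L"
    proof (rule feasible_demand_le[OF s_pos sporadic feasible I])
      show "0 \<le> L" using D0 L by simp
      fix i j assume i: "i \<in> I" and j: "j < n i"
      note pos = sporadic_taskD[OF T[OF i]]
      have "real j * period (\<tau> i) \<le> real (n i) * period (\<tau> i)"
        using j pos by (intro mult_right_mono) auto
      also have "\<dots> \<le> L - deadline (\<tau> i)"
        using n(1)[OF i] pos by (simp add: field_simps)
      finally show "real j * period (\<tau> i) + deadline (\<tau> i) \<le> L" by simp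
    qed
    finally show "L * ((\<Sum>i\<in>I. util (\<tau> i)) - real M * s)
        \<le> (\<Sum>i\<in>I. util (\<tau> i) * (deadline (\<tau> i) + period (\<tau> i)))"
      by (simp add: algebra_simps sum.distrib sum_subtractf sum_distrib_left)
  qed
  then show ?thesis by simp
qed

lemma feasible_sum_wcet_le:
  assumes s_pos: "0 < s" and sporadic: "\<forall>i\<in>{1..N}. sporadic_task (\<tau> i)"
    and feasible: "feasible M s N \<tau>"
    and "I \<subseteq> {1..N}" and "0 \<le> L" and "\<And>i. i \<in> I \<Longrightarrow> deadline (\<tau> i) \<le> L"
  shows "(\<Sum>i\<in>I. wcet (\<tau> i)) \<le> real M * s * L"
  using feasible_demand_le[OF assms(1-5), of "\<lambda>_. 1"] assms(6) by simp

section \<open>Test (E) from feasibility, and the speedup bound\<close>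

lemma feasible_imp_test_E:
  fixes \<tau> :: "nat \<Rightarrow> task"
  assumes "0 < s" and "(3 * real M - 1) * s \<le> real M" and "1 \<le> M"
    and sporadic: "\<forall>i\<in>{1..N}. sporadic_task (\<tau> i)"
    and DM: "\<forall>i\<in>{1..N}. \<forall>j\<in>{1..N}. i \<le> j \<longrightarrow> deadline (\<tau> i) \<le> deadline (\<tau> j)"
    and k: "k \<in> {1..N}" and feas: "feasible M s N \<tau>"
  shows "test_E M \<tau> k"
proof -
  note ctxt = \<open>0 < s\<close> sporadic feas
  have T: "sporadic_task (\<tau> k)" using sporadic k by blast
  note pos = sporadic_taskD[OF T]
  have split: "{1..k} = insert k {1..<k}" and sub: "{1..k} \<subseteq> {1..N}" using k by auto
  have hpT: "sporadic_task (\<tau> i)" if "i \<in> {1..<k}" for i using that sub sporadic by auto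
  define D where "D = deadline (\<tau> k)"
  define S where "S = (\<Sum>i\<in>{1..<k}. wcet (\<tau> i))"
  define V where "V = (\<Sum>i\<in>{1..<k}. util (\<tau> i))"
  have D0: "0 < D" using pos by (simp add: D_def)
  have "(\<Sum>i\<in>{1..k}. wcet (\<tau> i)) \<le> real M * s * D"
  proof (rule feasible_sum_wcet_le[OF ctxt sub])
    show "0 \<le> D" using D0 by simp
    \<comment> \<open>The DM order puts the first jobs of all tasks up to \<open>k\<close> inside
      the window \<open>{0..D}\<close>.\<close>
    show "deadline (\<tau> i) \<le> D" if "i \<in> {1..k}" for i
      using DM k sub that unfolding D_def by (meson atLeastAtMost_iff subsetD)
  qed
  then have "wcet (\<tau> k) + S \<le> real M * s * D" unfolding split S_def by simp
  then have "(wcet (\<tau> k) + S) / D \<le> real M * s" using D0 by (simp add: pos_divide_le_eq)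
  then have demand: "wcet (\<tau> k) / D + S / D \<le> real M * s" by (simp add: add_divide_distrib)
  have "(\<Sum>i\<in>{1..k}. util (\<tau> i)) \<le> real M * s"
    by (rule feasible_sum_util_le[OF ctxt sub])
  then have load: "util (\<tau> k) + V \<le> real M * s" unfolding split V_def by simp
  have "hp_load \<tau> k D \<le> (\<Sum>i\<in>{1..<k}. wcet (\<tau> i) / D + util (\<tau> i))"
    unfolding hp_load_def
  proof (rule sum_mono)
    fix i assume "i \<in> {1..<k}"
    note sporadic_taskD[OF hpT[OF this]]
    then show "(wcet (\<tau> i) - wcet (\<tau> i) * util (\<tau> i)) / D + util (\<tau> i)
        \<le> wcet (\<tau> i) / D + util (\<tau> i)"
      using D0 by (simp add: divide_right_mono)
  qed
  also have "\<dots> = S / D + V" by (simp add: sum.distrib S_def V_def sum_divide_distrib)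
  finally have hp: "hp_load \<tau> k D \<le> S / D + V" .
  \<comment> \<open>\<open>delta\<close> serves as the task-\<open>k\<close> term of either
    \<open>demand\<close> or \<open>load\<close>; the task-\<open>k\<close> term of the other is
    nonnegative and dropped.\<close>
  have "0 \<le> wcet (\<tau> k) / D" "0 \<le> util (\<tau> k)" using pos D0 by auto
  moreover have "delta (\<tau> k) = wcet (\<tau> k) / D \<or> delta (\<tau> k) = util (\<tau> k)"
    by (simp add: delta_def D_def util_def min_def)
  ultimately have "delta (\<tau> k) + hp_load \<tau> k D \<le> 2 * (real M * s)"
    using hp demand load by linarith
  \<comment> \<open>This is the speed hypothesis rearranged, and the origin of the constant
    \<open>3 - 1 / M\<close>.\<close>
  also have "\<dots> \<le> real M - (real M - 1) * s" using assms(2) by (simp add: algebra_simps)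
  also have "\<dots> \<le> real M - (real M - 1) * U_max \<tau> k"
  proof -
    have "U_max \<tau> k \<le> s"
      using k by (intro U_max_le feasible_delta_le[OF ctxt] feasible_util_le[OF ctxt]) auto
    then show ?thesis using \<open>1 \<le> M\<close> by (intro diff_left_mono mult_left_mono) auto
  qed
  finally show ?thesis by (simp add: test_E_def D_def)
qed

theorem theorem5p3:
  fixes M N k :: nat and \<tau> :: "nat \<Rightarrow> task"
  assumes "M \<ge> 2"
    and "\<forall>i\<in>{1..N}. sporadic_task (\<tau> i)"
    and "\<forall>i\<in>{1..N}. \<forall>j\<in>{1..N}. i \<le> j \<longrightarrow> deadline (\<tau> i) \<le> deadline (\<tau> j)"
    and "k \<in> {1..N}"
  shows "(\<not> test_A M \<tau> k \<longrightarrow> \<not> feasible M (1 / (3 - 1 / real M)) N \<tau>) \<and>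
         (\<not> test_B M \<tau> k \<longrightarrow> \<not> feasible M (1 / (3 - 1 / real M)) N \<tau>) \<and>
         (\<not> test_C M \<tau> k \<longrightarrow> \<not> feasible M (1 / (3 - 1 / real M)) N \<tau>) \<and>
         (deadline (\<tau> k) > period (\<tau> k) \<and> \<not> test_D M \<tau> k \<longrightarrow>
            \<not> feasible M (1 / (3 - 1 / real M)) N \<tau>) \<and>
         (\<not> test_E M \<tau> k \<longrightarrow> \<not> feasible M (1 / (3 - 1 / real M)) N \<tau>)"
proof -
  have "0 < 3 - 1 / real M" using assms(1) by (simp add: field_simps)
  moreover have "3 * real M - 1 = real M * (3 - 1 / real M)"
    using assms(1) by (simp add: right_diff_distrib)
  ultimately have s: "0 < 1 / (3 - 1 / real M)" "(3 * real M - 1) * (1 / (3 - 1 / real M)) \<le> real M"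
    by simp_all
  have E: "test_E M \<tau> k" if "feasible M (1 / (3 - 1 / real M)) N \<tau>"
    using feasible_imp_test_E[OF s _ assms(2-4) that] assms(1) by simp
  have hp: "sporadic_task (\<tau> k)" "\<forall>i\<in>{1..<k}. sporadic_task (\<tau> i)" and k: "1 \<le> k"
    using assms(2,4) unfolding Ball_def atLeastAtMost_iff atLeastLessThan_iff by simp_all
  note imps = test_E_imp_test_C[OF hp] test_E_imp_test_D[OF hp k]
    test_C_imp_test_A[OF hp] test_C_imp_test_B[OF hp]
  show ?thesis using E imps by blast
qed

end
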